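(* Let $d\ge 1$, $\Omega=[0,1]^d$, and $K(\xi)=\xi^{2\mathrm{k}}=\xi_1^{2k_1}\cdots\xi_d^{2k_d}$ for $\xi\in\Omega$, where $\mathrm{k}=(k_1,\ldots,k_d)\in\mathbb{N}^d$ has at least one positive entry. Let $\varphi$ be the probability density on $\Omega$ with $\varphi(\xi)\propto \xi^{\mathrm{h}}=\xi_1^{h_1}\cdots\xi_d^{h_d}$, where $\mathrm{h}=(h_1,\ldots,h_d)\in(0,\infty)^d$. Define $$\mathcal{Z}_K(n)=\int_\Omega e^{-nK(\xi)}\varphi(\xi)\,d\xi,\qquad \lambda=\min_{j}\frac{h_j+1}{2k_j},\qquad m=\sum_{j=1}^d \mathbf{1}\Big(\frac{h_j+1}{2k_j}=\lambda\Big).$$ Then there exist positive constants $C_1,C_2$ independent of $n$ such that for all integers $n\ge 2$ $$C_1\frac{(\log n)^{m-1}}{n^{\lambda}}<\mathcal{Z}_K(n)<C_2\frac{(\log n)^{m-1}}{n^{\lambda}}.$$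
   Context: $\mathbb{N}$ includes $0$. When $k_j=0$, the ratio $(h_j+1)/(2k_j)$ is interpreted as $+\infty$, so the minimum and the count effectively run over indices with $k_j>0$. The constants may depend on $d,\mathrm{k},\mathrm{h}$. *)

theory Defs
  imports "HOL-Analysis.Analysis"
begin

definition Omega :: "(real ^ 'd) set" where
  "Omega = cbox 0 1"

definition K_mono :: "nat ^ 'd \<Rightarrow> real ^ 'd \<Rightarrow> real" where
  "K_mono k \<xi> = (\<Prod>j\<in>UNIV. (\<xi> $ j) ^ (2 * k $ j))"

(* Only used with positive exponents on Omega, where 0 powr (h $ j) = 0 is the usual value. *)
definition powr_mono :: "real ^ 'd \<Rightarrow> real ^ 'd \<Rightarrow> real" where
  "powr_mono h \<xi> = (\<Prod>j\<in>UNIV. (\<xi> $ j) powr (h $ j))"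

definition prob_density_on :: "(real ^ 'd) set \<Rightarrow> (real ^ 'd \<Rightarrow> real) \<Rightarrow> bool" where
  "prob_density_on S \<phi> \<longleftrightarrow>
     (\<forall>\<xi>\<in>S. 0 \<le> \<phi> \<xi>) \<and> set_integrable lborel S \<phi> \<and> (LINT \<xi>:S|lborel. \<phi> \<xi>) = 1"

definition proportional_on :: "'a set \<Rightarrow> ('a \<Rightarrow> real) \<Rightarrow> ('a \<Rightarrow> real) \<Rightarrow> bool" where
  "proportional_on S f g \<longleftrightarrow> (\<exists>c. \<forall>x\<in>S. f x = c * g x)"

definition partition_fun :: "(real ^ 'd \<Rightarrow> real) \<Rightarrow> (real ^ 'd \<Rightarrow> real) \<Rightarrow> nat \<Rightarrow> real" where
  "partition_fun K \<phi> n = (LINT \<xi>:Omega|lborel. exp (- real n * K \<xi>) * \<phi> \<xi>)"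

(* Extended-real valued because a vanishing k $ j means ratio \<infinity>; real division would give 0. *)
definition ratio :: "nat ^ 'd \<Rightarrow> real ^ 'd \<Rightarrow> 'd \<Rightarrow> ereal" where
  "ratio k h j = (if k $ j = 0 then \<infinity> else ereal ((h $ j + 1) / (2 * real (k $ j))))"

(* The minimum is finite as soon as some k $ j is positive, so real_of_ereal loses nothing. *)
definition lam :: "nat ^ 'd \<Rightarrow> real ^ 'd \<Rightarrow> real" where
  "lam k h = real_of_ereal (MIN j. ratio k h j)"

definition min_count :: "nat ^ 'd \<Rightarrow> real ^ 'd \<Rightarrow> nat" where
  "min_count k h = (\<Sum>j\<in>UNIV. of_bool (ratio k h j = ereal (lam k h)))"

end

theory Submission
  imports Defs
begin

text \<open>
  The integral over the unnormalised density is computed one coordinate at a time: adding a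
  coordinate with exponents \<open>q = 2 * k $ j\<close> and \<open>a = h $ j\<close> turns \<open>f t\<close> into the integral of
  \<open>y powr a * f (t * y ^ q)\<close> over \<open>0 \<le> y \<le> 1\<close>. If \<open>f\<close> is of order
  \<open>ln (e + t) ^ p * (e + t) powr -l\<close> uniformly in \<open>t \<ge> 0\<close>, this raises \<open>p\<close> by one when
  \<open>a + 1 = q * l\<close> and preserves the order when \<open>a + 1 > q * l\<close>. Taking the coordinates of
  minimal ratio first, the first of them turns \<open>exp (-t)\<close> into the order \<open>(e + t) powr -l\<close>, the
  other minimal ones contribute one logarithm each, and the remaining coordinates
  (including those with \<open>k $ j = 0\<close>) change only the constants.
\<close>

section \<open>One-dimensional integrals of powers\<close>

lemma powr_minus_le_1:
  fixes u p :: real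
  assumes "u \<ge> 1" "p \<ge> 0"
  shows "u powr -p \<le> 1"
  using powr_mono[of "-p" 0 u] assms by simp

lemma nn_integral_powr_0:
  fixes p c :: real
  assumes "p > -1" "c \<ge> 0"
  shows "(\<integral>\<^sup>+y. ennreal (indicator {0..c} y * y powr p) \<partial>lborel) = ennreal (c powr (p + 1) / (p + 1))"
  using assms nn_integral_has_integral_lebesgue[OF _ has_integral_powr_from_0[of p c]] by simp

lemma nn_integral_inverse_Icc:
  fixes a :: real
  assumes "0 < a" "a \<le> 1"
  shows "(\<integral>\<^sup>+y. ennreal (indicator {a..1} y * (1 / y)) \<partial>lborel) = ennreal (- ln a)"
proof -
  have "((\<lambda>y. 1 / y) has_integral (ln 1 - ln a)) {a..1}"
    using assms
    by (intro fundamental_theorem_of_calculus)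
      (auto intro!: derivative_eq_intros simp flip: has_real_derivative_iff_has_vector_derivative)
  from nn_integral_has_integral_lebesgue[OF _ this] show ?thesis
    using assms by simp
qed

lemma nn_integral_powr_Icc_le:
  fixes a p :: real
  assumes "0 < a" "0 < p"
  shows "(\<integral>\<^sup>+y. ennreal (indicator {a..1} y * y powr (-p - 1)) \<partial>lborel) \<le> ennreal (a powr -p / p)"
proof -
  have "(\<integral>\<^sup>+y. ennreal (indicator {a..1} y * y powr (-p - 1)) \<partial>lborel)
      \<le> (\<integral>\<^sup>+y. ennreal (indicator {a..} y * y powr (-p - 1)) \<partial>lborel)"
    by (intro nn_integral_mono) (auto simp: indicator_def)
  also have "\<dots> = ennreal (a powr -p / p)"
    using nn_integral_has_integral_lebesgue[OF _ has_integral_powr_to_inf[of "-p - 1" a]] assms by simp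
  finally show ?thesis .
qed

section \<open>The comparison scale and the one-coordinate transform\<close>

text \<open>The shift by \<open>exp 1\<close> keeps the logarithm at least 1 for every
  \<open>t \<ge> 0\<close>. Bounds by this scale thus make sense uniformly down to
  \<open>t = 0\<close>, as required by arguments \<open>t * y ^ q\<close> that sweep all of
  \<open>[0, t]\<close>.\<close>

definition log_scale :: "real \<Rightarrow> nat \<Rightarrow> real \<Rightarrow> real" where
  "log_scale l p t = ln (exp 1 + t) ^ p * (exp 1 + t) powr -l"

text \<open>The indicator is part of the weight, so that all integrals run over the whole line and
  the cube factorises into coordinates.\<close>

definition mono_weight :: "real \<Rightarrow> real \<Rightarrow> real" where
  "mono_weight a y = indicator {0..1} y * y powr a"

definition mono_transform :: "nat \<Rightarrow> real \<Rightarrow> (real \<Rightarrow> ennreal) \<Rightarrow> real \<Rightarrow> ennreal" where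
  "mono_transform q a f t = (\<integral>\<^sup>+y. ennreal (mono_weight a y) * f (t * y ^ q) \<partial>lborel)"

lemma mono_weight_nonneg [simp]: "mono_weight a y \<ge> 0"
  by (simp add: mono_weight_def)

lemma measurable_mono_weight [measurable]: "mono_weight a \<in> borel_measurable borel"
  unfolding mono_weight_def by measurable

lemma exp1_plus_ge1: "t \<ge> 0 \<Longrightarrow> exp 1 + t \<ge> (1::real)"
  using one_le_exp_iff[of "1::real"] by linarith

lemma ln_exp1_plus_ge1: "t \<ge> 0 \<Longrightarrow> ln (exp 1 + t) \<ge> (1::real)"
  using ln_le_cancel_iff[of "exp 1" "exp 1 + t"] by (simp add: add_pos_nonneg)

lemma log_scale_nonneg: "t \<ge> 0 \<Longrightarrow> log_scale l p t \<ge> 0"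
  using ln_exp1_plus_ge1[of t] by (simp add: log_scale_def)

lemma exp1_plus_bounds:
  fixes t y :: real and q :: nat
  assumes "t \<ge> 0" "0 < y" "y \<le> 1"
  shows "(exp 1 + t) * y ^ q \<le> exp 1 + t * y ^ q" "exp 1 + t * y ^ q \<le> exp 1 + t"
proof -
  have "y ^ q \<le> 1" using assms by (simp add: power_le_one)
  then have "exp 1 * y ^ q \<le> exp 1 * 1" "t * y ^ q \<le> t * 1"
    using assms by (auto intro!: mult_left_mono simp del: mult_1_right)
  then show "(exp 1 + t) * y ^ q \<le> exp 1 + t * y ^ q" "exp 1 + t * y ^ q \<le> exp 1 + t"
    by (simp_all add: algebra_simps)
qed

text \<open>By \<open>(exp 1 + t) * y ^ q \<le> exp 1 + t * y ^ q \<le> exp 1 + t\<close>, the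
  logarithm does not grow and the negative power grows at most by the stated factor. In the upper
  bounds this factor competes with the weight \<open>y powr a\<close>.\<close>

lemma log_scale_mult_power_le:
  fixes t y :: real and q :: nat
  assumes "t \<ge> 0" "0 < y" "y \<le> 1" "l \<ge> 0"
  shows "log_scale l p (t * y ^ q) \<le> log_scale l p t * y powr - (real q * l)"
proof -
  note b = exp1_plus_bounds[OF assms(1-3), of q]
  have pos: "(exp 1 + t) * y ^ q > 0" using assms by (simp add: add_pos_nonneg)
  have "(exp 1 + t * y ^ q) powr -l \<le> ((exp 1 + t) * y ^ q) powr -l"
    using b pos assms by (intro powr_mono2') auto
  also have "\<dots> = (exp 1 + t) powr -l * y powr - (real q * l)"
    using assms by (simp add: powr_mult add_nonneg_nonneg powr_realpow[symmetric] powr_powr)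
  finally have 1: "(exp 1 + t * y ^ q) powr -l \<le> (exp 1 + t) powr -l * y powr - (real q * l)" .
  have 2: "ln (exp 1 + t * y ^ q) ^ p \<le> ln (exp 1 + t) ^ p"
    using b pos ln_exp1_plus_ge1[of "t * y ^ q"] assms by (intro power_mono) (auto simp: add_pos_nonneg exp1_plus_ge1)
  have "ln (exp 1 + t * y ^ q) ^ p * (exp 1 + t * y ^ q) powr -l
     \<le> ln (exp 1 + t) ^ p * ((exp 1 + t) powr -l * y powr - (real q * l))"
    using 1 2 ln_exp1_plus_ge1[of t] assms by (intro mult_mono) auto
  then show ?thesis by (simp add: log_scale_def mult_ac)
qed

section \<open>The transform of functions of log-power order\<close>

text \<open>The integrand is dominated by the scale at \<open>t\<close> times
  \<open>y powr (a - q * l)\<close>. This exponent exceeds -1, so the integral over the unit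
  interval converges and no logarithm appears. The case \<open>q = 0\<close> is included.\<close>

lemma mono_transform_upper_gt:
  fixes a l C t :: real
  assumes "l \<ge> 0" "a + 1 > real q * l" "C \<ge> 0" "t \<ge> 0"
    and f: "\<And>s. s \<ge> 0 \<Longrightarrow> f s \<le> ennreal (C * log_scale l p s)"
  shows "mono_transform q a f t \<le> ennreal (C / (a + 1 - real q * l) * log_scale l p t)"
proof -
  define r where "r = a - real q * l"
  have r: "r > -1" using assms by (simp add: r_def)
  define A where "A = C * log_scale l p t"
  have A: "A \<ge> 0" using assms by (simp add: A_def log_scale_nonneg)
  have "mono_transform q a f t \<le> (\<integral>\<^sup>+y. ennreal A * ennreal (indicator {0..1} y * y powr r) \<partial>lborel)"
    unfolding mono_transform_def
  proof (intro nn_integral_mono)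
    fix y :: real
    show "ennreal (mono_weight a y) * f (t * y ^ q) \<le> ennreal A * ennreal (indicator {0..1} y * y powr r)"
    \<comment> \<open>The point \<open>y = 0\<close> belongs to the trivial case, because
      \<open>0 powr a = 0\<close>.\<close>
    proof (cases "0 < y \<and> y \<le> 1")
      case True
      have "f (t * y ^ q) \<le> ennreal (C * log_scale l p (t * y ^ q))"
        using f[of "t * y ^ q"] assms True by simp
      also have "\<dots> \<le> ennreal (A * y powr - (real q * l))"
        using log_scale_mult_power_le[of t y l p q] assms True
        by (intro ennreal_leI) (auto simp: A_def mult.assoc intro!: mult_left_mono)
      finally have "ennreal (mono_weight a y) * f (t * y ^ q)
          \<le> ennreal (y powr a) * ennreal (A * y powr - (real q * l))"
        using True by (intro mult_mono) (auto simp: mono_weight_def)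
      also have "\<dots> = ennreal (A * y powr r)"
        using True A by (simp add: ennreal_mult'[symmetric] r_def diff_conv_add_uminus powr_add mult_ac del: add_uminus_conv_diff)
      also have "\<dots> = ennreal A * ennreal (indicator {0..1} y * y powr r)"
        using True A by (simp add: ennreal_mult')
      finally show ?thesis .
    qed (auto simp: mono_weight_def indicator_def)
  qed
  also have "\<dots> = ennreal A * ennreal (1 / (r + 1))"
    using nn_integral_powr_0[of r 1] r by (simp add: nn_integral_cmult)
  also have "\<dots> = ennreal (C / (a + 1 - real q * l) * log_scale l p t)"
    using A r by (simp add: ennreal_mult'[symmetric] A_def r_def algebra_simps)
  finally show ?thesis .
qed

text \<open>On the unit interval \<open>t * y ^ q \<le> t\<close>, so \<open>f\<close> may be
  replaced by its value at \<open>t\<close>; the weight has total mass \<open>1 / (a + 1)\<close>.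
  This serves the coordinates of non-minimal ratio.\<close>

lemma mono_transform_lower_antimono:
  fixes a t :: real
  assumes "a > -1" "t \<ge> 0" and f: "\<And>s. 0 \<le> s \<Longrightarrow> s \<le> t \<Longrightarrow> f t \<le> f s"
  shows "ennreal (1 / (a + 1)) * f t \<le> mono_transform q a f t"
proof -
  have "ennreal (1 / (a + 1)) * f t = (\<integral>\<^sup>+y. f t * ennreal (indicator {0..1} y * y powr a) \<partial>lborel)"
    using nn_integral_powr_0[of a 1] assms by (simp add: nn_integral_cmult mult.commute)
  also have "\<dots> \<le> mono_transform q a f t"
    unfolding mono_transform_def
  proof (intro nn_integral_mono)
    fix y :: real
    show "f t * ennreal (indicator {0..1} y * y powr a) \<le> ennreal (mono_weight a y) * f (t * y ^ q)"
    proof (cases "0 \<le> y \<and> y \<le> 1")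
      case True
      then have "t * y ^ q \<le> t" using assms by (simp add: mult_left_le power_le_one)
      then have "f t \<le> f (t * y ^ q)" using f[of "t * y ^ q"] assms True by simp
      then show ?thesis
        using True by (simp add: mono_weight_def mult.commute[of "f t"] mult_left_mono)
    qed (auto simp: mono_weight_def indicator_def)
  qed
  finally show ?thesis .
qed

text \<open>For \<open>q * l = a + 1\<close> the integrand is split at \<open>y = (e + t) powr (-1/q)\<close>, where the two
  terms of \<open>e + t * y ^ q\<close> are comparable; the part above contributes the additional logarithm.\<close>

lemma mono_transform_upper_eq:
  fixes a l C t :: real
  assumes "q > 0" "l > 0" "a + 1 = real q * l" "C \<ge> 0" "t \<ge> 0"
    and f: "\<And>s. s \<ge> 0 \<Longrightarrow> f s \<le> ennreal (C * log_scale l p s)"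
  shows "mono_transform q a f t \<le> ennreal (C * (1 / (a + 1) + 1 / q) * log_scale l (Suc p) t)"
proof -
  define u where "u = exp 1 + t"
  define c where "c = u powr (-1 / q)"
  have u: "u \<ge> 1" using assms(5) by (simp add: u_def add_increasing2)
  have u': "ln u \<ge> 1" using ln_exp1_plus_ge1 assms by (simp add: u_def)
  have c: "0 < c" "c \<le> 1" using u assms by (auto simp: c_def powr_minus_le_1)
  have a: "a + 1 > 0" using assms by simp
  define w where "w = - ln c"
  have w: "w \<ge> 0" using c by (simp add: w_def)
  \<comment> \<open>For \<open>y \<le> c\<close> the power factor of the scale is bounded by 1,
    which leaves \<open>A\<close>. Beyond \<open>c\<close> the factor
    \<open>y powr - (q * l)\<close> meets the weight \<open>y powr a\<close>, and
    \<open>q * l = a + 1\<close> turns the bound into \<open>B / y\<close>.\<close>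
  define A where "A = C * ln u ^ p"
  define B where "B = A * u powr -l"
  have A: "A \<ge> 0" using assms u' by (simp add: A_def)
  have B: "B \<ge> 0" using A by (simp add: B_def)
  have "mono_transform q a f t \<le> (\<integral>\<^sup>+y. ennreal A * ennreal (indicator {0..c} y * y powr a)
       + ennreal B * ennreal (indicator {c..1} y * (1 / y)) \<partial>lborel)"
    unfolding mono_transform_def
  proof (intro nn_integral_mono)
    fix y :: real
    show "ennreal (mono_weight a y) * f (t * y ^ q) \<le> ennreal A * ennreal (indicator {0..c} y * y powr a)
       + ennreal B * ennreal (indicator {c..1} y * (1 / y))"
    proof (cases "0 < y \<and> y \<le> 1")
      case True
      then have y: "0 < y" "y \<le> 1" by auto
      have s: "t * y ^ q \<ge> 0" using assms True by simp
      have ft: "f (t * y ^ q) \<le> ennreal (C * log_scale l p (t * y ^ q))"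
        using f[OF s] .
      show ?thesis
      proof (cases "y \<le> c")
        case yc: True
        have 1: "ln (exp 1 + t * y ^ q) ^ p \<le> ln u ^ p"
          using exp1_plus_bounds(2)[OF assms(5) y, of q] s ln_exp1_plus_ge1[OF s]
          by (intro power_mono) (auto simp: u_def add_pos_nonneg exp1_plus_ge1)
        have 2: "(exp 1 + t * y ^ q) powr -l \<le> 1"
        proof -
          have "(exp 1 + t * y ^ q) powr -l \<le> 1 powr -l"
            using s assms by (intro powr_mono2') (auto simp: add_increasing2)
          then show ?thesis by simp
        qed
        have "log_scale l p (t * y ^ q) \<le> ln u ^ p * 1"
          unfolding log_scale_def using 1 2 u' by (intro mult_mono) auto
        then have "f (t * y ^ q) \<le> ennreal A"
          using assms by (intro order_trans[OF ft] ennreal_leI) (auto simp: A_def intro!: mult_left_mono)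
        then have "ennreal (mono_weight a y) * f (t * y ^ q) \<le> ennreal (y powr a) * ennreal A"
          using True by (intro mult_mono) (auto simp: mono_weight_def)
        also have "\<dots> \<le> ennreal A * ennreal (indicator {0..c} y * y powr a)
       + ennreal B * ennreal (indicator {c..1} y * (1 / y))"
          using True yc by (simp add: mult.commute)
        finally show ?thesis .
      next
        case yc: False
        have "C * log_scale l p (t * y ^ q) \<le> B * y powr - (a + 1)"
          using log_scale_mult_power_le[OF assms(5) y, of l p q] assms
          by (auto simp: B_def A_def log_scale_def u_def mult.assoc intro!: mult_left_mono)
        then have "f (t * y ^ q) \<le> ennreal (B * y powr - (a + 1))"
          by (intro order_trans[OF ft] ennreal_leI)
        then have "ennreal (mono_weight a y) * f (t * y ^ q) \<le> ennreal (y powr a) * ennreal (B * y powr - (a + 1))"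
          using True by (intro mult_mono) (auto simp: mono_weight_def)
        also have "\<dots> = ennreal (B * (y powr a * y powr - (a + 1)))"
          using B by (simp add: ennreal_mult'[symmetric] mult_ac)
        also have "y powr a * y powr - (a + 1) = 1 / y"
          using y by (simp add: powr_add[symmetric] powr_minus_divide)
        also have "ennreal (B * (1 / y)) \<le> ennreal A * ennreal (indicator {0..c} y * y powr a)
       + ennreal B * ennreal (indicator {c..1} y * (1 / y))"
          using y yc B by (simp add: ennreal_mult'[symmetric])
        finally show ?thesis .
      qed
    qed (auto simp: mono_weight_def indicator_def)
  qed
  also have "\<dots> = ennreal A * ennreal (c powr (a + 1) / (a + 1)) + ennreal B * ennreal w"
    using nn_integral_powr_0[of a c] nn_integral_inverse_Icc[of c] c a
    unfolding w_def
    by (simp add: nn_integral_add nn_integral_cmult)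
  also have "\<dots> = ennreal (A * (c powr (a + 1) / (a + 1)) + B * w)"
    using A B a w by (simp add: ennreal_mult'[symmetric] ennreal_plus[symmetric] del: ennreal_plus)
  also have "\<dots> \<le> ennreal (C * (1 / (a + 1) + 1 / q) * log_scale l (Suc p) t)"
  proof (intro ennreal_leI)
    \<comment> \<open>The choice of \<open>c\<close> gives the part below it the size
      \<open>B / (a + 1)\<close> and the part above it \<open>B * ln u / q\<close>. The former is
      absorbed into the logarithmic term since \<open>ln u \<ge> 1\<close>.\<close>
    have e1: "c powr (a + 1) = u powr -l"
      using assms by (simp add: c_def powr_powr)
    have e2: "w = ln u / q"
      using u by (simp add: w_def c_def ln_powr)
    have "A * (c powr (a + 1) / (a + 1)) + B * w = B * (1 / (a + 1) + ln u / q)"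
      unfolding e1 e2 by (simp add: B_def algebra_simps)
    also have "\<dots> \<le> B * (ln u / (a + 1) + ln u / q)"
      using B u' a by (intro mult_left_mono add_mono divide_right_mono) auto
    also have "\<dots> = C * (1 / (a + 1) + 1 / q) * log_scale l (Suc p) t"
      by (simp add: B_def A_def log_scale_def u_def algebra_simps add_divide_distrib)
    finally show "A * (c powr (a + 1) / (a + 1)) + B * w \<le> C * (1 / (a + 1) + 1 / q) * log_scale l (Suc p) t" .
  qed
  finally show ?thesis .
qed

text \<open>Above \<open>y = (e + t) powr (-1/(2q))\<close> one has \<open>e + t * y ^ q \<ge> sqrt (e + t)\<close>, so passing to the
  argument \<open>t * y ^ q\<close> loses at most half of the logarithm.\<close>

lemma mono_transform_lower_eq:
  fixes a l C t :: real
  assumes "q > 0" "l > 0" "a + 1 = real q * l" "C \<ge> 0" "t \<ge> 0"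
    and f: "\<And>s. s \<ge> 0 \<Longrightarrow> ennreal (C * log_scale l p s) \<le> f s"
  shows "ennreal (C * (1/2) ^ p * (exp 1 + 1) powr -l / (2 * q) * log_scale l (Suc p) t) \<le> mono_transform q a f t"
proof -
  define u where "u = exp 1 + t"
  define c where "c = u powr (-1 / (2 * q))"
  have u: "u \<ge> 1" using assms(5) by (simp add: u_def add_increasing2)
  have u': "ln u \<ge> 1" using ln_exp1_plus_ge1 assms by (simp add: u_def)
  have c: "0 < c" "c \<le> 1" using u assms by (auto simp: c_def powr_minus_le_1)
  \<comment> \<open>\<open>ln u / 2\<close> is the logarithm of the square root of \<open>u\<close>.
    The factor \<open>exp 1 + 1\<close> comes from
    \<open>exp 1 + t * y ^ q \<le> (exp 1 + 1) * u * y ^ q\<close>, valid for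
    \<open>c \<le> y \<le> 1\<close> because there \<open>u * y ^ q \<ge> 1\<close>.\<close>
  define B where "B = C * (ln u / 2) ^ p * ((exp 1 + 1) * u) powr -l"
  have B: "B \<ge> 0" using assms u' by (simp add: B_def)
  have "C * (1/2) ^ p * (exp 1 + 1) powr -l / (2 * q) * log_scale l (Suc p) t = B * (- ln c)"
    using u by (simp add: B_def log_scale_def c_def ln_powr u_def powr_mult power_divide add_pos_pos)
  then have "ennreal (C * (1/2) ^ p * (exp 1 + 1) powr -l / (2 * q) * log_scale l (Suc p) t)
      = ennreal B * ennreal (- ln c)"
    using B by (simp only: ennreal_mult')
  also have "\<dots> = (\<integral>\<^sup>+y. ennreal B * ennreal (indicator {c..1} y * (1 / y)) \<partial>lborel)"
    using B c nn_integral_inverse_Icc[of c]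
    by (subst nn_integral_cmult) simp_all
  also have "\<dots> \<le> mono_transform q a f t"
    unfolding mono_transform_def
  proof (intro nn_integral_mono)
    fix y :: real
    show "ennreal B * ennreal (indicator {c..1} y * (1 / y)) \<le> ennreal (mono_weight a y) * f (t * y ^ q)"
    proof (cases "c \<le> y \<and> y \<le> 1")
      case True
      then have y: "0 < y" "y \<le> 1" using c by auto
      define v where "v = exp 1 + t * y ^ q"
      have s: "t * y ^ q \<ge> 0" using assms y by simp
      have "u powr (-1/2) = c ^ q"
        using c assms by (simp add: c_def powr_realpow[symmetric] powr_powr)
      also have "\<dots> \<le> y ^ q" using True c by (intro power_mono) auto
      finally have "u * u powr (-1/2) \<le> u * y ^ q" using u by (intro mult_left_mono) auto
      moreover have "u * u powr (-1/2) = u powr (1/2)"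
        using u powr_mult_base[of u "-1/2"] by simp
      ultimately have uy: "u powr (1/2) \<le> u * y ^ q" by simp
      also have "u * y ^ q \<le> v"
        using exp1_plus_bounds(1)[OF assms(5) y, of q] by (simp add: u_def v_def)
      finally have uv: "u powr (1/2) \<le> v" .
      have "ln u / 2 = ln (u powr (1/2))" using u by (simp add: ln_powr)
      also have "\<dots> \<le> ln v" using uv u by (intro iffD2[OF ln_le_cancel_iff]) (auto simp: v_def s add_pos_nonneg)
      finally have 1: "(ln u / 2) ^ p \<le> ln v ^ p" using u' by (intro power_mono) auto
      have "1 \<le> u powr (1/2)" using u by (simp add: ge_one_powr_ge_zero)
      with uy have "1 \<le> u * y ^ q" by simp
      then have "exp 1 * 1 \<le> exp 1 * (u * y ^ q)" by (intro mult_left_mono) auto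
      moreover have "t * y ^ q \<le> u * y ^ q" using y by (intro mult_right_mono) (auto simp: u_def)
      ultimately have "v \<le> exp 1 * (u * y ^ q) + u * y ^ q" unfolding v_def by linarith
      then have "v \<le> (exp 1 + 1) * u * y ^ q" by (simp add: algebra_simps)
      then have "((exp 1 + 1) * u * y ^ q) powr -l \<le> v powr -l"
        using s assms by (intro powr_mono2') (auto simp: v_def add_pos_nonneg)
      then have 2: "((exp 1 + 1) * u) powr -l * y powr - (a + 1) \<le> v powr -l"
        using assms y u by (simp add: powr_mult add_nonneg_nonneg powr_realpow[symmetric] powr_powr)
      have "(ln u / 2) ^ p * (((exp 1 + 1) * u) powr -l * y powr - (a + 1)) \<le> ln v ^ p * v powr -l"
        using 1 2 u' order_trans[OF _ 1, of 0] by (intro mult_mono) auto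
      then have "B * y powr - (a + 1) \<le> C * log_scale l p (t * y ^ q)"
        using assms by (auto simp: B_def log_scale_def v_def mult.assoc intro!: mult_left_mono)
      then have "ennreal (B * y powr - (a + 1)) \<le> f (t * y ^ q)"
        by (intro order_trans[OF ennreal_leI f[OF s]])
      then have "ennreal (y powr a) * ennreal (B * y powr - (a + 1)) \<le> ennreal (mono_weight a y) * f (t * y ^ q)"
        using y by (intro mult_mono) (auto simp: mono_weight_def)
      also have "ennreal (y powr a) * ennreal (B * y powr - (a + 1)) = ennreal (B * (y powr a * y powr - (a + 1)))"
        using B by (simp add: ennreal_mult'[symmetric] mult_ac)
      also have "y powr a * y powr - (a + 1) = 1 / y"
        using y by (simp add: powr_add[symmetric] powr_minus_divide)
      also have "ennreal (B * (1 / y)) = ennreal B * ennreal (indicator {c..1} y * (1 / y))"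
        using y True B by (simp add: ennreal_mult'[symmetric])
      finally show ?thesis .
    qed (auto simp: indicator_def)
  qed
  finally show ?thesis .
qed

section \<open>The exponential as starting function\<close>

text \<open>The constant is the value of \<open>exp (-s) * (exp 1 + s) powr p\<close> at its
  critical point \<open>exp 1 + s = p\<close>. The inequality \<open>ln x \<le> x - 1\<close> at
  \<open>x = (exp 1 + s) / p\<close> replaces the calculus.\<close>

lemma exp_minus_le_powr:
  fixes p s :: real
  assumes "p > 0" "s \<ge> 0"
  shows "exp (-s) \<le> exp (exp 1 - p + p * ln p) * (exp 1 + s) powr -p"
proof -
  have pos: "exp 1 + s > 0" using assms by (simp add: add_pos_nonneg)
  have "ln ((exp 1 + s) / p) \<le> (exp 1 + s) / p - 1"
    using pos assms by (intro ln_le_minus_one) auto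
  then have "p * ln ((exp 1 + s) / p) \<le> p * ((exp 1 + s) / p - 1)"
    using assms by (intro mult_left_mono) auto
  also have "\<dots> = exp 1 + s - p"
    using assms by (simp add: field_simps)
  finally have "-s \<le> exp 1 - p + p * ln p + (- p * ln (exp 1 + s))"
    using assms pos by (simp add: ln_div algebra_simps)
  then have "exp (-s) \<le> exp (exp 1 - p + p * ln p + (- p * ln (exp 1 + s)))" by simp
  also have "\<dots> = exp (exp 1 - p + p * ln p) * (exp 1 + s) powr -p"
    using pos by (simp add: exp_add[symmetric] powr_def)
  finally show ?thesis .
qed

text \<open>The integral is split where \<open>u * y ^ q = 1\<close>, with
  \<open>u = exp 1 + t\<close>. Below, the exponential is at most 1. Above, it is replaced by a
  power decay of exponent \<open>2 * l\<close>: exponent \<open>l\<close> would leave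
  \<open>1 / y\<close> and hence a logarithm, whereas the doubled one leaves
  \<open>y powr (- (a + 1) - 1)\<close>. Both parts are then of order
  \<open>u powr -l\<close>.\<close>

lemma mono_transform_exp_upper:
  fixes a l t :: real
  assumes "q > 0" "l > 0" "a + 1 = real q * l" "t \<ge> 0"
  shows "mono_transform q a (\<lambda>s. ennreal (exp (-s))) t
     \<le> ennreal ((1 + exp (exp 1 - 2 * l + 2 * l * ln (2 * l))) / (a + 1) * log_scale l 0 t)"
proof -
  define u where "u = exp 1 + t"
  define c where "c = u powr (-1 / q)"
  have u: "u \<ge> 1" using assms by (simp add: u_def add_increasing2)
  have c: "0 < c" "c \<le> 1" using u assms by (auto simp: c_def powr_minus_le_1)
  have a: "a + 1 > 0" using assms by simp
  define D where "D = exp (exp 1 - 2 * l + 2 * l * ln (2 * l))"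
  define B where "B = D * u powr - (2 * l)"
  have B: "B \<ge> 0" by (simp add: B_def D_def)
  have "mono_transform q a (\<lambda>s. ennreal (exp (-s))) t \<le> (\<integral>\<^sup>+y. ennreal (indicator {0..c} y * y powr a)
       + ennreal B * ennreal (indicator {c..1} y * y powr (- (a + 1) - 1)) \<partial>lborel)"
    unfolding mono_transform_def
  proof (intro nn_integral_mono)
    fix y :: real
    show "ennreal (mono_weight a y) * ennreal (exp (- (t * y ^ q))) \<le> ennreal (indicator {0..c} y * y powr a)
       + ennreal B * ennreal (indicator {c..1} y * y powr (- (a + 1) - 1))"
    proof (cases "0 < y \<and> y \<le> 1")
      case True
      then have y: "0 < y" "y \<le> 1" by auto
      have s: "t * y ^ q \<ge> 0" using assms True by simp
      show ?thesis
      proof (cases "y \<le> c")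
        case yc: True
        have "mono_weight a y * exp (- (t * y ^ q)) \<le> mono_weight a y * 1"
          using s by (intro mult_left_mono) auto
        then have "ennreal (mono_weight a y) * ennreal (exp (- (t * y ^ q))) \<le> ennreal (indicator {0..c} y * y powr a)"
          using y yc by (subst ennreal_mult'[symmetric]) (auto simp: mono_weight_def intro!: ennreal_leI)
        then show ?thesis by (rule order_trans) simp
      next
        case yc: False
        have "exp (- (t * y ^ q)) \<le> D * log_scale (2 * l) 0 (t * y ^ q)"
          using exp_minus_le_powr[OF _ s, of "2 * l"] assms by (simp add: D_def log_scale_def)
        also have "\<dots> \<le> D * (log_scale (2 * l) 0 t * y powr - (real q * (2 * l)))"
          using assms y by (intro mult_left_mono log_scale_mult_power_le) (auto simp: D_def)
        also have "\<dots> = B * y powr - (2 * (a + 1))"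
          using assms by (simp add: B_def u_def log_scale_def mult_ac)
        finally have "y powr a * exp (- (t * y ^ q)) \<le> y powr a * (B * y powr - (2 * (a + 1)))"
          by (intro mult_left_mono) auto
        also have "\<dots> = B * (y powr a * y powr - (2 * (a + 1)))" by simp
        also have "y powr a * y powr - (2 * (a + 1)) = y powr (- (a + 1) - 1)"
          by (simp add: powr_add[symmetric] algebra_simps)
        finally have "ennreal (mono_weight a y) * ennreal (exp (- (t * y ^ q)))
            \<le> ennreal B * ennreal (indicator {c..1} y * y powr (- (a + 1) - 1))"
          using y yc B by (simp add: mono_weight_def ennreal_mult'[symmetric] ennreal_leI)
        then show ?thesis by (rule order_trans) simp
      qed
    qed (auto simp: mono_weight_def indicator_def)
  qed
  also have "\<dots> \<le> ennreal (c powr (a + 1) / (a + 1)) + ennreal B * ennreal (c powr - (a + 1) / (a + 1))"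
    using nn_integral_powr_0[of a c] nn_integral_powr_Icc_le[of c "a + 1"] c a
    by (simp add: nn_integral_add nn_integral_cmult mult_left_mono del: minus_add_distrib)
  also have "\<dots> = ennreal (c powr (a + 1) / (a + 1) + B * (c powr - (a + 1) / (a + 1)))"
    using B a c by (simp add: ennreal_mult'[symmetric] ennreal_plus[symmetric] del: ennreal_plus)
  also have "c powr (a + 1) / (a + 1) + B * (c powr - (a + 1) / (a + 1)) = (1 + D) / (a + 1) * log_scale l 0 t"
  proof -
    have e1: "c powr (a + 1) = u powr -l" "c powr - (a + 1) = u powr l"
      using assms by (simp_all add: c_def powr_powr)
    have "u powr - (2 * l) * u powr l = u powr -l" by (simp add: powr_add[symmetric])
    then show ?thesis
      unfolding e1 by (simp add: B_def log_scale_def u_def add_divide_distrib ring_distribs)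
  qed
  finally show ?thesis by (simp add: D_def)
qed

text \<open>Only \<open>y \<le> c\<close> is kept, where \<open>t * y ^ q \<le> 1\<close> and the
  exponential is at least \<open>exp (-1)\<close>. The weight of this interval is
  \<open>u powr -l / (a + 1)\<close>.\<close>

lemma mono_transform_exp_lower:
  fixes a l t :: real
  assumes "q > 0" "l > 0" "a + 1 = real q * l" "t \<ge> 0"
  shows "ennreal (exp (-1) / (a + 1) * log_scale l 0 t) \<le> mono_transform q a (\<lambda>s. ennreal (exp (-s))) t"
proof -
  define u where "u = exp 1 + t"
  define c where "c = u powr (-1 / q)"
  have u: "u \<ge> 1" using assms by (simp add: u_def add_increasing2)
  have c: "0 < c" "c \<le> 1" using u assms by (auto simp: c_def powr_minus_le_1)
  have a: "a + 1 > 0" using assms by simp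
  have e1: "c powr (a + 1) = u powr -l"
    using assms by (simp add: c_def powr_powr)
  have "ennreal (exp (-1) / (a + 1) * log_scale l 0 t) = ennreal (exp (-1)) * ennreal (c powr (a + 1) / (a + 1))"
    unfolding e1 by (simp add: ennreal_mult'[symmetric] log_scale_def u_def)
  also have "\<dots> = (\<integral>\<^sup>+y. ennreal (exp (-1)) * ennreal (indicator {0..c} y * y powr a) \<partial>lborel)"
    using nn_integral_powr_0[of a c] c a by (simp add: nn_integral_cmult)
  also have "\<dots> \<le> mono_transform q a (\<lambda>s. ennreal (exp (-s))) t"
    unfolding mono_transform_def
  proof (intro nn_integral_mono)
    fix y :: real
    show "ennreal (exp (-1)) * ennreal (indicator {0..c} y * y powr a)
       \<le> ennreal (mono_weight a y) * ennreal (exp (- (t * y ^ q)))"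
    proof (cases "0 \<le> y \<and> y \<le> c")
      case True
      have "t * y ^ q \<le> u * c ^ q" using True assms by (intro mult_mono power_mono) (auto simp: u_def)
      also have "c ^ q = u powr -1"
        using c assms by (simp add: c_def powr_realpow[symmetric] powr_powr del: powr_neg_one)
      also have "\<dots> = inverse u" using u by (simp add: powr_minus)
      also have "u * inverse u = 1" using u by simp
      finally have "exp (-1) * y powr a \<le> y powr a * exp (- (t * y ^ q))" by (simp add: mult.commute[of "exp (-1)"] mult_left_mono)
      then show ?thesis
        using True c by (simp add: mono_weight_def ennreal_mult'[symmetric] ennreal_leI)
    qed (auto simp: indicator_def)
  qed
  finally show ?thesis .
qed

section \<open>Iterated integration over the coordinates\<close>

text \<open>The free index set \<open>J\<close> and the real parameter \<open>t\<close> make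
  induction on coordinates possible: fixing one coordinate at \<open>y\<close> only replaces
  \<open>t\<close> by \<open>t * y ^ q\<close>.\<close>

definition cube_integral :: "('i \<Rightarrow> nat) \<Rightarrow> ('i \<Rightarrow> real) \<Rightarrow> 'i set \<Rightarrow> real \<Rightarrow> ennreal" where
  "cube_integral q a J t = (\<integral>\<^sup>+x. ennreal (exp (- (t * (\<Prod>j\<in>J. x j ^ q j))) * (\<Prod>j\<in>J. mono_weight (a j) (x j)))
     \<partial>PiM J (\<lambda>_. lborel))"

lemma cube_integral_empty: "cube_integral q a {} t = ennreal (exp (-t))"
  by (simp add: cube_integral_def PiM_empty)

text \<open>Tonelli with the new coordinate outermost; its power is absorbed into the parameter, and
  its weight is pulled out of the inner integral.\<close>

lemma cube_integral_insert:
  assumes "finite J" "i \<notin> J"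
  shows "cube_integral q a (insert i J) t = mono_transform (q i) (a i) (cube_integral q a J) t"
proof -
  interpret product_sigma_finite "\<lambda>_::'a. lborel :: real measure" by standard
  let ?f = "\<lambda>x. ennreal (exp (- (t * (\<Prod>j\<in>insert i J. x j ^ q j))) * (\<Prod>j\<in>insert i J. mono_weight (a j) (x j)))"
  have "cube_integral q a (insert i J) t
      = (\<integral>\<^sup>+y. (\<integral>\<^sup>+x. ?f (x(i := y)) \<partial>PiM J (\<lambda>_. lborel)) \<partial>lborel)"
    unfolding cube_integral_def by (rule product_nn_integral_insert_rev[OF assms]) measurable
  also have "\<dots> = mono_transform (q i) (a i) (cube_integral q a J) t"
    unfolding mono_transform_def
  proof (intro nn_integral_cong)
    fix y :: real
    have "?f (x(i := y)) = ennreal (mono_weight (a i) y) *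
        ennreal (exp (- (t * y ^ q i * (\<Prod>j\<in>J. x j ^ q j))) * (\<Prod>j\<in>J. mono_weight (a j) (x j)))" for x
    proof -
      have "(\<Prod>j\<in>J. (x(i := y)) j ^ q j) = (\<Prod>j\<in>J. x j ^ q j)"
        "(\<Prod>j\<in>J. mono_weight (a j) ((x(i := y)) j)) = (\<Prod>j\<in>J. mono_weight (a j) (x j))"
        using assms by (auto intro!: prod.cong)
      then show ?thesis
        using assms by (simp add: prod.insert ennreal_mult'[symmetric] mult_ac)
    qed
    then show "(\<integral>\<^sup>+x. ?f (x(i := y)) \<partial>PiM J (\<lambda>_. lborel))
        = ennreal (mono_weight (a i) y) * cube_integral q a J (t * y ^ q i)"
      unfolding cube_integral_def by (simp only:) (rule nn_integral_cmult; measurable)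
  qed
  finally show ?thesis .
qed

text \<open>Where no weight vanishes, all coordinates are nonnegative, so the monomial multiplying
  \<open>t\<close> is nonnegative even for odd exponents.\<close>

lemma cube_integral_antimono:
  assumes "s \<le> t"
  shows "cube_integral q a J t \<le> cube_integral q a J s"
  unfolding cube_integral_def
proof (intro nn_integral_mono ennreal_leI)
  fix x :: "'a \<Rightarrow> real"
  show "exp (- (t * (\<Prod>j\<in>J. x j ^ q j))) * (\<Prod>j\<in>J. mono_weight (a j) (x j))
      \<le> exp (- (s * (\<Prod>j\<in>J. x j ^ q j))) * (\<Prod>j\<in>J. mono_weight (a j) (x j))"
  proof (cases "\<forall>j\<in>J. x j \<ge> 0")
    case True
    then show ?thesis
      using assms by (intro mult_right_mono prod_nonneg) (auto intro!: mult_right_mono prod_nonneg)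
  next
    case False
    then obtain j where j: "j \<in> J" "mono_weight (a j) (x j) = 0"
      by (auto simp: mono_weight_def)
    show ?thesis
    \<comment> \<open>For infinite \<open>J\<close> both products are 1 by convention, and the claim
      is \<open>exp (-t) \<le> exp (-s)\<close>.\<close>
    proof (cases "finite J")
      case True
      then have "(\<Prod>j\<in>J. mono_weight (a j) (x j)) = 0" using j by (auto simp: prod_zero_iff)
      then show ?thesis by simp
    qed (use assms in simp)
  qed
qed

text \<open>The base case is a single coordinate, which turns the exponential into a pure power;
  only the later ones produce logarithms, hence the exponent \<open>card M - 1\<close>.\<close>

lemma cube_integral_minimal_bounds:
  fixes l :: real
  assumes "finite M" "M \<noteq> {}" "l > 0" and "\<And>j. j \<in> M \<Longrightarrow> q j > 0 \<and> a j + 1 = real (q j) * l"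
  shows "\<exists>C1>0. \<exists>C2>0. \<forall>t\<ge>0. ennreal (C1 * log_scale l (card M - 1) t) \<le> cube_integral q a M t \<and>
           cube_integral q a M t \<le> ennreal (C2 * log_scale l (card M - 1) t)"
  using assms
proof (induction M rule: finite_ne_induct)
  case (singleton j)
  then have j: "q j > 0" "a j + 1 = real (q j) * l" by auto
  then have a: "a j + 1 > 0" using singleton by simp
  have e: "cube_integral q a {j} = mono_transform (q j) (a j) (\<lambda>s. ennreal (exp (-s)))"
    using cube_integral_insert[of "{}" j q a] by (simp add: cube_integral_empty[abs_def] fun_eq_iff)
  let ?C1 = "exp (-1) / (a j + 1)"
  let ?C2 = "(1 + exp (exp 1 - 2 * l + 2 * l * ln (2 * l))) / (a j + 1)"
  have "?C1 > 0" "?C2 > 0" using a by (auto intro!: divide_pos_pos add_pos_pos)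
  moreover have "card {j} - 1 = 0" by simp
  moreover note mono_transform_exp_lower[OF j(1) \<open>l > 0\<close> j(2)] mono_transform_exp_upper[OF j(1) \<open>l > 0\<close> j(2)]
  ultimately show ?case unfolding e by metis
next
  case (insert j M)
  then have j: "q j > 0" "a j + 1 = real (q j) * l" by auto
  then have a: "a j + 1 > 0" using insert.prems by simp
  obtain C1 C2 where C: "C1 > 0" "C2 > 0"
    and lo: "\<And>t. t \<ge> 0 \<Longrightarrow> ennreal (C1 * log_scale l (card M - 1) t) \<le> cube_integral q a M t"
    and up: "\<And>t. t \<ge> 0 \<Longrightarrow> cube_integral q a M t \<le> ennreal (C2 * log_scale l (card M - 1) t)"
    using insert by blast
  \<comment> \<open>The truncated subtraction is exact, since \<open>M\<close> is nonempty.\<close>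
  have card: "card (insert j M) - 1 = Suc (card M - 1)"
    using insert.hyps by (simp add: card_gt_0_iff)
  have e: "cube_integral q a (insert j M) = mono_transform (q j) (a j) (cube_integral q a M)"
    using insert.hyps by (simp add: cube_integral_insert fun_eq_iff)
  let ?C1 = "C1 * (1/2) ^ (card M - 1) * (exp 1 + 1) powr -l / (2 * q j)"
  let ?C2 = "C2 * (1 / (a j + 1) + 1 / q j)"
  have "(exp 1 + 1 :: real) \<noteq> 0" using exp_gt_zero[of "1::real"] by linarith
  then have "?C1 > 0" "?C2 > 0" using a j(1) C by (auto intro!: mult_pos_pos divide_pos_pos add_pos_pos)
  moreover have "ennreal (?C1 * log_scale l (Suc (card M - 1)) t) \<le> mono_transform (q j) (a j) (cube_integral q a M) t"
    "mono_transform (q j) (a j) (cube_integral q a M) t \<le> ennreal (?C2 * log_scale l (Suc (card M - 1)) t)"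
    if "t \<ge> 0" for t
    using mono_transform_lower_eq[OF j(1) \<open>l > 0\<close> j(2) less_imp_le[OF C(1)] that lo]
      mono_transform_upper_eq[OF j(1) \<open>l > 0\<close> j(2) less_imp_le[OF C(2)] that up] by simp_all
  ultimately show ?case
    unfolding card e by blast
qed

text \<open>Induction on \<open>R\<close> starts from the completed block \<open>M\<close>, whose
  integral already has the order with exponent \<open>l\<close>. Each further coordinate keeps that
  order: from above by the strict inequality on its exponents, from below by antimonotonicity in
  \<open>t\<close>.\<close>

lemma cube_integral_bounds:
  fixes l :: real
  assumes "finite R" "finite M" "M \<noteq> {}" "M \<inter> R = {}" "l > 0"
    and "\<And>j. j \<in> M \<Longrightarrow> q j > 0 \<and> a j + 1 = real (q j) * l"
    and "\<And>j. j \<in> R \<Longrightarrow> a j + 1 > real (q j) * l"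
  shows "\<exists>C1>0. \<exists>C2>0. \<forall>t\<ge>0. ennreal (C1 * log_scale l (card M - 1) t) \<le> cube_integral q a (M \<union> R) t \<and>
           cube_integral q a (M \<union> R) t \<le> ennreal (C2 * log_scale l (card M - 1) t)"
  using assms(1,4,7)
proof (induction R rule: finite_induct)
  case empty
  then show ?case using cube_integral_minimal_bounds[OF assms(2,3,5,6)] by simp
next
  case (insert j R)
  have j: "a j + 1 > real (q j) * l" using insert.prems by simp
  moreover have "real (q j) * l \<ge> 0" using assms by simp
  ultimately have a: "a j > -1" by linarith
  obtain C1 C2 where C: "C1 > 0" "C2 > 0"
    and lo: "\<And>t. t \<ge> 0 \<Longrightarrow> ennreal (C1 * log_scale l (card M - 1) t) \<le> cube_integral q a (M \<union> R) t"
    and up: "\<And>t. t \<ge> 0 \<Longrightarrow> cube_integral q a (M \<union> R) t \<le> ennreal (C2 * log_scale l (card M - 1) t)"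
    using insert.IH insert.prems by auto
  have e: "cube_integral q a (M \<union> insert j R) = mono_transform (q j) (a j) (cube_integral q a (M \<union> R))"
    using insert.hyps insert.prems assms by (simp add: cube_integral_insert fun_eq_iff)
  have "ennreal (C1 / (a j + 1) * log_scale l (card M - 1) t)
      \<le> mono_transform (q j) (a j) (cube_integral q a (M \<union> R)) t" if t: "t \<ge> 0" for t
  proof -
    have "ennreal (C1 / (a j + 1) * log_scale l (card M - 1) t)
        = ennreal (1 / (a j + 1)) * ennreal (C1 * log_scale l (card M - 1) t)"
      using a by (simp add: ennreal_mult'[symmetric])
    also have "\<dots> \<le> ennreal (1 / (a j + 1)) * cube_integral q a (M \<union> R) t"
      using lo[OF t] by (intro mult_left_mono) auto
    also have "\<dots> \<le> mono_transform (q j) (a j) (cube_integral q a (M \<union> R)) t"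
      using a t by (intro mono_transform_lower_antimono cube_integral_antimono)
    finally show ?thesis .
  qed
  then show ?case
    unfolding e
    using mono_transform_upper_gt[OF less_imp_le[OF assms(5)] j less_imp_le[OF C(2)] _ up] a j C
    by (intro exI[of _ "C1 / (a j + 1)"] exI[of _ "C2 / (a j + 1 - real (q j) * l)"] conjI)
      (auto intro!: divide_pos_pos)
qed

section \<open>Passage to Lebesgue measure and to integer parameters\<close>

text \<open>\<open>lborel\<close> is the image of the product measure over \<open>Basis\<close>
  under the map that assembles a vector from its coordinates.\<close>

lemma nn_integral_lborel_eq_cube_integral:
  fixes q :: "'a::euclidean_space \<Rightarrow> nat"
  shows "(\<integral>\<^sup>+\<xi>. ennreal (exp (- (t * (\<Prod>b\<in>Basis. (\<xi> \<bullet> b) ^ q b))) * (\<Prod>b\<in>Basis. mono_weight (a b) (\<xi> \<bullet> b))) \<partial>lborel)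
    = cube_integral q a Basis t"
proof -
  have "(\<integral>\<^sup>+\<xi>. ennreal (exp (- (t * (\<Prod>b\<in>Basis. (\<xi> \<bullet> b) ^ q b))) * (\<Prod>b\<in>Basis. mono_weight (a b) (\<xi> \<bullet> b))) \<partial>lborel)
     = (\<integral>\<^sup>+x. ennreal (exp (- (t * (\<Prod>b\<in>Basis. ((\<Sum>b\<in>Basis. x b *\<^sub>R b) \<bullet> b) ^ q b)))
         * (\<Prod>b\<in>Basis. mono_weight (a b) ((\<Sum>b\<in>Basis. x b *\<^sub>R b) \<bullet> b))) \<partial>PiM Basis (\<lambda>_. lborel))"
    by (subst lborel_eq, subst nn_integral_distr) measurable
  also have "\<dots> = cube_integral q a Basis t"
    unfolding cube_integral_def by (intro nn_integral_cong) simp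
  finally show ?thesis .
qed

text \<open>For \<open>n \<ge> 2\<close> one has \<open>exp 1 + n \<le> 3 * n\<close> and
  \<open>3 \<le> n ^ 2\<close>, hence \<open>ln (exp 1 + n) \<le> 3 * ln n\<close>. At
  \<open>n = 1\<close> the upper bound would fail for \<open>p > 0\<close>, as
  \<open>ln 1 = 0\<close>.\<close>

lemma log_scale_nat_bounds:
  fixes n :: nat and l :: real
  assumes "n \<ge> 2" "l > 0"
  shows "3 powr -l * (ln (real n) ^ p / real n powr l) \<le> log_scale l p (real n)"
    "log_scale l p (real n) \<le> 3 ^ p * (ln (real n) ^ p / real n powr l)"
proof -
  have n: "real n \<ge> 2" using assms by simp
  have u: "exp 1 + real n \<le> 3 * real n" using exp_le n by linarith
  have lnn: "ln (real n) > 0" using n by simp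
  have "ln (exp 1 + real n) \<le> ln (3 * real n)"
    using u n by (intro iffD2[OF ln_le_cancel_iff]) (auto simp: add_pos_pos)
  also have "\<dots> = ln 3 + ln (real n)" using n by (simp add: ln_mult)
  also have "ln 3 \<le> 2 * ln (real n)"
  proof -
    have "ln 3 \<le> ln ((real n) ^ 2)"
      using n power_mono[of 2 "real n" 2] by (intro iffD2[OF ln_le_cancel_iff]) auto
    then show ?thesis using n by (simp add: ln_realpow)
  qed
  finally have "ln (exp 1 + real n) \<le> 3 * ln (real n)" by simp
  then have "ln (exp 1 + real n) ^ p \<le> (3 * ln (real n)) ^ p"
    using ln_exp1_plus_ge1[of "real n"] by (intro power_mono) auto
  moreover have "(exp 1 + real n) powr -l \<le> real n powr -l"
    using n assms by (intro powr_mono2') auto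
  ultimately have "log_scale l p (real n) \<le> (3 * ln (real n)) ^ p * real n powr -l"
    unfolding log_scale_def using lnn by (intro mult_mono) auto
  then show "log_scale l p (real n) \<le> 3 ^ p * (ln (real n) ^ p / real n powr l)"
    by (simp add: power_mult_distrib powr_minus_divide)
  have "ln (real n) ^ p \<le> ln (exp 1 + real n) ^ p"
    using lnn n by (intro power_mono) (auto simp: add_pos_pos)
  moreover have "(3 * real n) powr -l \<le> (exp 1 + real n) powr -l"
    using u n assms by (intro powr_mono2') (auto simp: add_pos_pos)
  ultimately have "ln (real n) ^ p * (3 * real n) powr -l \<le> log_scale l p (real n)"
    unfolding log_scale_def using lnn ln_exp1_plus_ge1[of "real n"] by (intro mult_mono) auto
  then show "3 powr -l * (ln (real n) ^ p / real n powr l) \<le> log_scale l p (real n)"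
    using n by (simp add: powr_mult powr_minus_divide)
qed


section \<open>Coordinates, basis vectors and the weight on the cube\<close>

lemma bij_betw_axis_Basis: "bij_betw (\<lambda>j. axis j 1) (UNIV :: 'd::finite set) (Basis :: (real ^ 'd) set)"
  by (auto simp: bij_betw_def inj_on_def axis_eq_axis Basis_vec_def)

lemma prod_UNIV_eq_prod_Basis:
  fixes f :: "'d::finite \<Rightarrow> real \<Rightarrow> 'b::comm_monoid_mult" and \<xi> :: "real ^ 'd"
  shows "(\<Prod>j\<in>UNIV. f j (\<xi> $ j)) = (\<Prod>b\<in>Basis. f (axis_index b) (\<xi> \<bullet> b))"
  by (subst prod.reindex_bij_betw[OF bij_betw_axis_Basis, symmetric]) (simp add: cart_eq_inner_axis)

lemma indicator_Omega_powr_mono: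
  "indicator Omega \<xi> * powr_mono h \<xi> = (\<Prod>j\<in>UNIV. mono_weight (h $ j) (\<xi> $ j))"
proof (cases "\<xi> \<in> Omega")
  case True
  then show ?thesis
    by (auto simp: Omega_def mem_box_cart powr_mono_def mono_weight_def intro!: prod.cong)
next
  case False
  then obtain j where "\<xi> $ j \<notin> {0..1}"
    by (auto simp: Omega_def mem_box_cart)
  then have "mono_weight (h $ j) (\<xi> $ j) = 0" by (simp add: mono_weight_def)
  then have "(\<Prod>j\<in>UNIV. mono_weight (h $ j) (\<xi> $ j)) = 0"
    by (auto simp: prod_zero_iff)
  then show ?thesis using False by simp
qed

lemma nn_integral_Omega_eq_cube_integral:
  fixes k :: "nat ^ 'd" and h :: "real ^ 'd"
  shows "(\<integral>\<^sup>+\<xi>. ennreal (exp (- t * K_mono k \<xi>) * (indicator Omega \<xi> * powr_mono h \<xi>)) \<partial>lborel)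
     = cube_integral (\<lambda>b. 2 * k $ axis_index b) (\<lambda>b. h $ axis_index b) (Basis :: (real ^ 'd) set) t"
  unfolding indicator_Omega_powr_mono K_mono_def prod_UNIV_eq_prod_Basis[of "\<lambda>j. mono_weight (h $ j)"]
    prod_UNIV_eq_prod_Basis[of "\<lambda>j x. x ^ (2 * k $ j)"]
  using nn_integral_lborel_eq_cube_integral[of t "\<lambda>b. 2 * k $ axis_index b" "\<lambda>b. h $ axis_index b"] by simp

section \<open>The minimal ratio and its multiplicity\<close>

text \<open>A positive entry of \<open>k\<close> makes the minimum finite. It is therefore attained
  at an index with \<open>k $ j > 0\<close>, where the ratio is an explicit positive real.\<close>

lemma lam_properties:
  fixes k :: "nat ^ 'd" and h :: "real ^ 'd"
  assumes "\<exists>j. k $ j > 0" "\<forall>j. h $ j > 0"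
  shows "lam k h > 0" "\<exists>j. ratio k h j = ereal (lam k h)" "\<And>j. ereal (lam k h) \<le> ratio k h j"
proof -
  let ?m = "MIN j. ratio k h j"
  obtain i where "k $ i > 0" using assms by blast
  then have "ratio k h i < \<infinity>" by (simp add: ratio_def)
  moreover have le: "?m \<le> ratio k h j" for j by simp
  ultimately have fin: "?m < \<infinity>" by (meson le_less_trans)
  have "?m \<in> range (ratio k h)" by (intro Min_in) auto
  then obtain j where j: "ratio k h j = ?m" by (metis imageE)
  with fin have k: "k $ j > 0" by (cases "k $ j = 0") (auto simp: ratio_def)
  have lam: "lam k h = (h $ j + 1) / (2 * real (k $ j))"
    unfolding lam_def j[symmetric] using k by (simp add: ratio_def)
  have m: "ereal (lam k h) = ?m"
    unfolding j[symmetric] lam using k by (simp add: ratio_def)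
  show "lam k h > 0" using k assms by (auto simp: lam intro!: divide_pos_pos add_pos_pos)
  show "\<exists>j. ratio k h j = ereal (lam k h)" using j m by metis
  show "ereal (lam k h) \<le> ratio k h j" for j using le m by metis
qed

text \<open>With \<open>q = 2 * k $ j\<close> and \<open>a = h $ j\<close>, minimal ratio means
  \<open>a + 1 = q * lam k h\<close>, and any other index satisfies the strict inequality. An
  infinite ratio has \<open>q = 0\<close>, where that inequality reads
  \<open>a + 1 > 0\<close>.\<close>

lemma cube_integral_lam_bounds:
  fixes k :: "nat ^ 'd" and h :: "real ^ 'd"
  assumes "\<exists>j. k $ j > 0" "\<forall>j. h $ j > 0"
  shows "\<exists>C1>0. \<exists>C2>0. \<forall>t\<ge>0.
    ennreal (C1 * log_scale (lam k h) (min_count k h - 1) t)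
      \<le> cube_integral (\<lambda>b. 2 * k $ axis_index b) (\<lambda>b. h $ axis_index b) (Basis :: (real ^ 'd) set) t \<and>
    cube_integral (\<lambda>b. 2 * k $ axis_index b) (\<lambda>b. h $ axis_index b) (Basis :: (real ^ 'd) set) t
      \<le> ennreal (C2 * log_scale (lam k h) (min_count k h - 1) t)"
proof -
  note lam = lam_properties[OF assms]
  let ?P = "\<lambda>j. ratio k h j = ereal (lam k h)"
  define M where "M = (\<lambda>j. axis j 1 :: real ^ 'd) ` {j. ?P j}"
  define R where "R = (\<lambda>j. axis j 1 :: real ^ 'd) ` {j. \<not> ?P j}"
  have "M \<union> R = (\<lambda>j. axis j 1) ` UNIV" by (auto simp: M_def R_def)
  then have B: "M \<union> R = Basis" using bij_betw_axis_Basis[where 'd='d] by (simp add: bij_betw_def)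
  have card: "card M = min_count k h"
    unfolding M_def min_count_def by (subst card_image) (auto simp: inj_on_def axis_eq_axis)
  have "\<exists>C1>0. \<exists>C2>0. \<forall>t\<ge>0.
    ennreal (C1 * log_scale (lam k h) (card M - 1) t)
      \<le> cube_integral (\<lambda>b. 2 * k $ axis_index b) (\<lambda>b. h $ axis_index b) (M \<union> R) t \<and>
    cube_integral (\<lambda>b. 2 * k $ axis_index b) (\<lambda>b. h $ axis_index b) (M \<union> R) t
      \<le> ennreal (C2 * log_scale (lam k h) (card M - 1) t)"
  proof (rule cube_integral_bounds)
    show "finite M" "finite R" "M \<inter> R = {}" by (auto simp: M_def R_def axis_eq_axis)
    show "M \<noteq> {}" "lam k h > 0" using lam by (auto simp: M_def)
  next
    fix b assume "b \<in> M"
    then obtain j where "b = axis j 1" "?P j" by (auto simp: M_def)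
    then show "2 * k $ axis_index b > 0 \<and> h $ axis_index b + 1 = real (2 * k $ axis_index b) * lam k h"
      by (auto simp: ratio_def field_simps split: if_splits)
  next
    fix b assume "b \<in> R"
    then obtain j where b: "b = axis j 1" "\<not> ?P j" by (auto simp: R_def)
    then have "ereal (lam k h) < ratio k h j" using lam(3)[of j] by (simp add: order_less_le)
    moreover have "h $ j > 0" using assms by simp
    ultimately show "h $ axis_index b + 1 > real (2 * k $ axis_index b) * lam k h"
      using b by (auto simp: ratio_def field_simps split: if_splits)
  qed
  then show ?thesis unfolding B card .
qed

section \<open>Normalisation and strict two-sided bounds\<close>

theorem theorem2p2:
  fixes k :: "nat ^ 'd" and h :: "real ^ 'd" and \<phi> :: "real ^ 'd \<Rightarrow> real"
  assumes "\<exists>j. k $ j > 0"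
    and "\<forall>j. h $ j > 0"
    and "prob_density_on Omega \<phi>"
    and "proportional_on Omega \<phi> (powr_mono h)"
  shows "\<exists>C1 > 0. \<exists>C2 > 0. \<forall>n::nat. n \<ge> 2 \<longrightarrow>
           C1 * (ln (real n) ^ (min_count k h - 1) / real n powr lam k h) < partition_fun (K_mono k) \<phi> n \<and>
           partition_fun (K_mono k) \<phi> n < C2 * (ln (real n) ^ (min_count k h - 1) / real n powr lam k h)"
proof -
  let ?F = "cube_integral (\<lambda>b. 2 * k $ axis_index b) (\<lambda>b. h $ axis_index b) (Basis :: (real ^ 'd) set)"
  let ?w = "\<lambda>\<xi>. indicator Omega \<xi> * powr_mono h \<xi>"
  define p where "p = min_count k h - 1"
  define l where "l = lam k h"
  have l: "l > 0" using lam_properties[OF assms(1,2)] by (simp add: l_def)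
  obtain c where c: "\<And>\<xi>. \<xi> \<in> Omega \<Longrightarrow> \<phi> \<xi> = c * powr_mono h \<xi>"
    using assms(4) by (auto simp: proportional_on_def)
  have w_nonneg: "?w \<xi> \<ge> 0" for \<xi>
    by (simp add: indicator_Omega_powr_mono prod_nonneg)
  have w_meas [measurable]: "?w \<in> borel_measurable borel"
    unfolding indicator_Omega_powr_mono by measurable
  have "(LINT \<xi>:Omega|lborel. \<phi> \<xi>) = (LINT \<xi>|lborel. c * ?w \<xi>)"
    unfolding set_lebesgue_integral_def
    by (intro Bochner_Integration.integral_cong) (auto simp: c indicator_def)
  \<comment> \<open>Proportionality leaves the sign of \<open>c\<close> open; total mass 1 against a
    nonnegative weight forces \<open>c > 0\<close>.\<close>
  then have "1 = c * (LINT \<xi>|lborel. ?w \<xi>)"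
    using assms(3) by (simp add: prob_density_on_def)
  moreover have "(LINT \<xi>|lborel. ?w \<xi>) \<ge> 0" using w_nonneg by simp
  ultimately have c_pos: "c > 0"
    by (metis mult_nonpos_nonneg not_le not_one_le_zero)
  have Z: "partition_fun (K_mono k) \<phi> n = c * enn2real (?F (real n))" for n
  proof -
    have "partition_fun (K_mono k) \<phi> n = (LINT \<xi>|lborel. c * (exp (- real n * K_mono k \<xi>) * ?w \<xi>))"
      unfolding partition_fun_def set_lebesgue_integral_def
      by (intro Bochner_Integration.integral_cong) (auto simp: c indicator_def)
    also have "\<dots> = c * (LINT \<xi>|lborel. exp (- real n * K_mono k \<xi>) * ?w \<xi>)" by simp
    also have "(LINT \<xi>|lborel. exp (- real n * K_mono k \<xi>) * ?w \<xi>) = enn2real (?F (real n))"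
      unfolding nn_integral_Omega_eq_cube_integral[symmetric]
    proof (intro integral_eq_nn_integral)
      show "(\<lambda>\<xi>. exp (- real n * K_mono k \<xi>) * ?w \<xi>) \<in> borel_measurable lborel"
        unfolding K_mono_def by measurable
    qed (use w_nonneg in simp)
    finally show ?thesis .
  qed
  obtain C1 C2 where C: "C1 > 0" "C2 > 0"
    and lo: "\<And>t. t \<ge> 0 \<Longrightarrow> ennreal (C1 * log_scale l p t) \<le> ?F t"
    and up: "\<And>t. t \<ge> 0 \<Longrightarrow> ?F t \<le> ennreal (C2 * log_scale l p t)"
    using cube_integral_lam_bounds[OF assms(1,2)] unfolding l_def p_def by blast
  define D1 where "D1 = c * C1 * 3 powr -l"
  define D2 where "D2 = c * C2 * 3 ^ p"
  have D: "D1 > 0" "D2 > 0" using c_pos C by (auto simp: D1_def D2_def)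
  \<comment> \<open>Halving and doubling the constants makes the bounds strict, because the
    comparison term is positive for \<open>n \<ge> 2\<close>.\<close>
  have "D1 / 2 * (ln (real n) ^ p / real n powr l) < partition_fun (K_mono k) \<phi> n \<and>
     partition_fun (K_mono k) \<phi> n < 2 * D2 * (ln (real n) ^ p / real n powr l)" if n: "n \<ge> 2" for n
  proof -
    define g where "g = ln (real n) ^ p / real n powr l"
    have g: "g > 0" using n by (auto simp: g_def intro!: divide_pos_pos)
    have s: "log_scale l p (real n) \<ge> 0" by (simp add: log_scale_nonneg)
    note b = log_scale_nat_bounds[OF n l, of p, folded g_def]
    \<comment> \<open>Finiteness matters for the lower bound: \<open>enn2real\<close> sends
      \<open>top\<close> to 0 and is monotone only below it.\<close>
    have "?F (real n) < top" using up[of "real n"] by (simp add: le_less_trans)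
    then have "C1 * log_scale l p (real n) \<le> enn2real (?F (real n))"
      using enn2real_mono[OF lo[of "real n"]] C s by simp
    moreover have "enn2real (?F (real n)) \<le> C2 * log_scale l p (real n)"
      using enn2real_mono[OF up[of "real n"]] C s by simp
    moreover have "C1 * (3 powr -l * g) \<le> C1 * log_scale l p (real n)"
      "C2 * log_scale l p (real n) \<le> C2 * (3 ^ p * g)"
      using b C by (auto intro!: mult_left_mono)
    ultimately have "C1 * (3 powr -l * g) \<le> enn2real (?F (real n))"
      "enn2real (?F (real n)) \<le> C2 * (3 ^ p * g)" by linarith+
    then have "c * (C1 * (3 powr -l * g)) \<le> partition_fun (K_mono k) \<phi> n"
      "partition_fun (K_mono k) \<phi> n \<le> c * (C2 * (3 ^ p * g))"
      unfolding Z using c_pos by (auto intro!: mult_left_mono)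
    then have "D1 * g \<le> partition_fun (K_mono k) \<phi> n" "partition_fun (K_mono k) \<phi> n \<le> D2 * g"
      by (simp_all add: D1_def D2_def mult.assoc)
    moreover have "D1 * g > 0" "D2 * g > 0" using D g by simp_all
    ultimately show ?thesis unfolding g_def[symmetric] by simp
  qed
  moreover have "D1 / 2 > 0" "2 * D2 > 0" using D by simp_all
  ultimately show ?thesis
    unfolding p_def l_def by blast
qed

end
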